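(* Let $n\geq 4$ and $0\le p\le 1$. In the $n$-dimensional bubble-sort network $B_n$ under the random node fault model in which each node is fault-free independently with probability $p$, $$P(1,3,0)=P(0,3,1)=P(0,1,3)=\tfrac{1}{6}(n^8-7n^7+21n^6-35n^5+34n^4-18n^3+4n^2)p^{4(n-2)!}+\tfrac{1}{2}(n^7-7n^6+21n^5-35n^4+34n^3-18n^2+4n)p^{4(n-2)!-(n-3)!}+\tfrac{1}{2}(n^6-8n^5+25n^4-40n^3+34n^2-12n)p^{4(n-2)!-2(n-3)!}+\tfrac{1}{6}(n^5-10n^4+35n^3-50n^2+24n)p^{4(n-2)!-3(n-3)!}.$$
   Context: Let $N_n=\{1,\dots,n\}$. The bubble-sort network $B_n$ has as vertices the permutations of $N_n$, written as strings $u_1u_2\cdots u_n$, two permutations being adjacent iff they differ by swapping two adjacent positions $u_i,u_{i+1}$. For distinct $a_1,a_2\in N_n$, a $B_{n-2}$-subnetwork of $B_n$ is one of the following vertex sets (each inducing a copy of $B_{n-2}$ and having $(n-2)!$ vertices): $a_1a_2X^{n-2}$, the set of permutations with $u_1=a_1,u_2=a_2$ ("prefix form"); $a_1X^{n-2}a_2$, the set with $u_1=a_1,u_n=a_2$ ("middle form"); $X^{n-2}a_1a_2$, the set with $u_{n-1}=a_1,u_n=a_2$ ("suffix form"). Each form gives $n(n-1)$ subnetworks. In the random node fault model each vertex is fault-free independently with probability $p$ (faulty with probability $1-p$); a subnetwork is fault-free if all its vertices are. For nonnegative integers $i,j,k$ with $i+j+k=4$, $P(i,j,k)$ denotes the sum,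 over all sets $S$ of four distinct $B_{n-2}$-subnetworks consisting of $i$ of prefix form, $j$ of middle form and $k$ of suffix form, of the probability that all four members of $S$ are fault-free, i.e. of $p^{|\bigcup_{H\in S}H|}$. (The paper calls $P(i,j,k)$ "the probability that there are four fault-free $B_{n-2}$'s, $i$ of which are of prefix form, $j$ of middle form and $k$ of suffix form".) *)

theory Defs
  imports
    "HOL-Combinatorics.Multiset_Permutations"
    "HOL-Probability.Probability"
    "Graph_Theory.Pair_Digraph"
begin

text \<open>A vertex \<open>u\<^sub>1u\<^sub>2\<dots>u\<^sub>n\<close> is a list, so \<open>u\<^sub>i\<close> is \<open>u ! (i - 1)\<close>. The undirected network is
  represented by its symmetric digraph.\<close>

definition bubble_sort_network :: "nat \<Rightarrow> nat list pair_pre_digraph" where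
  "bubble_sort_network n =
    \<lparr> pverts = permutations_of_set {1..n},
      parcs = {(u, v). u \<in> permutations_of_set {1..n} \<and>
                 (\<exists>i. Suc i < n \<and> v = u[i := u ! Suc i, Suc i := u ! i])} \<rparr>"

definition prefix_subnet :: "nat \<Rightarrow> nat \<Rightarrow> nat \<Rightarrow> nat list set" where
  "prefix_subnet n a b = {u \<in> pverts (bubble_sort_network n). u ! 0 = a \<and> u ! 1 = b}"

definition middle_subnet :: "nat \<Rightarrow> nat \<Rightarrow> nat \<Rightarrow> nat list set" where
  "middle_subnet n a b = {u \<in> pverts (bubble_sort_network n). u ! 0 = a \<and> u ! (n - 1) = b}"

definition suffix_subnet :: "nat \<Rightarrow> nat \<Rightarrow> nat \<Rightarrow> nat list set" where
  "suffix_subnet n a b = {u \<in> pverts (bubble_sort_network n). u ! (n - 2) = a \<and> u ! (n - 1) = b}"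

definition prefix_subnets :: "nat \<Rightarrow> nat list set set" where
  "prefix_subnets n = {prefix_subnet n a b | a b. a \<in> {1..n} \<and> b \<in> {1..n} \<and> a \<noteq> b}"

definition middle_subnets :: "nat \<Rightarrow> nat list set set" where
  "middle_subnets n = {middle_subnet n a b | a b. a \<in> {1..n} \<and> b \<in> {1..n} \<and> a \<noteq> b}"

definition suffix_subnets :: "nat \<Rightarrow> nat list set set" where
  "suffix_subnets n = {suffix_subnet n a b | a b. a \<in> {1..n} \<and> b \<in> {1..n} \<and> a \<noteq> b}"

text \<open>An outcome \<open>\<omega>\<close> says for each vertex whether it is fault-free; the value \<open>False\<close> passed to
  \<^const>\<open>Pi_pmf\<close> is only the dummy value taken outside the vertex set. The model is meaningful
  for \<open>0 \<le> p \<le> 1\<close>, since \<^const>\<open>bernoulli_pmf\<close> clamps its parameter to that interval.\<close>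

definition node_fault_model :: "nat \<Rightarrow> real \<Rightarrow> (nat list \<Rightarrow> bool) pmf" where
  "node_fault_model n p =
    Pi_pmf (pverts (bubble_sort_network n)) False (\<lambda>_. bernoulli_pmf p)"

definition fault_free :: "(nat list \<Rightarrow> bool) \<Rightarrow> nat list set \<Rightarrow> bool" where
  "fault_free \<omega> H \<longleftrightarrow> (\<forall>v\<in>H. \<omega> v)"

text \<open>For \<open>n \<ge> 4\<close> the three families of subnetworks are pairwise disjoint, so the three
  cardinalities describe a partition of \<open>S\<close>.\<close>

definition subnet_choices :: "nat \<Rightarrow> nat \<Rightarrow> nat \<Rightarrow> nat \<Rightarrow> nat list set set set" where
  "subnet_choices n i j k =
    {S. S \<subseteq> prefix_subnets n \<union> middle_subnets n \<union> suffix_subnets n \<and> card S = 4 \<and>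
        card (S \<inter> prefix_subnets n) = i \<and>
        card (S \<inter> middle_subnets n) = j \<and>
        card (S \<inter> suffix_subnets n) = k}"

text \<open>This is a sum of probabilities over overlapping events (hence may exceed 1), not the
  probability that some such choice is fault-free.\<close>

definition prob_fault_free :: "nat \<Rightarrow> real \<Rightarrow> nat \<Rightarrow> nat \<Rightarrow> nat \<Rightarrow> real" where
  "prob_fault_free n p i j k =
    (\<Sum>S\<in>subnet_choices n i j k.
       measure_pmf.prob (node_fault_model n p) {\<omega>. \<forall>H\<in>S. fault_free \<omega> H})"

end

theory Submission
  imports Defs
begin

text \<open>All three cases have the same shape: one subnetwork \<open>H\<close> fixing positions \<open>i, j\<close> and three
  subnetworks fixing positions \<open>i, k\<close>. The latter are pairwise disjoint, and each meets \<open>H\<close> either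
  not at all or, when it agrees with \<open>H\<close> at \<open>i\<close> and its symbol at \<open>k\<close> differs from that of \<open>H\<close> at
  \<open>j\<close>, in \<open>(n - 3)!\<close> permutations. Exactly \<open>n - 2\<close> of the \<open>n (n - 1)\<close> candidates meet \<open>H\<close>, so
  a hypergeometric count over the number of chosen ones meeting \<open>H\<close> yields the four terms.\<close>

section \<open>Permutations with prescribed entries\<close>

text \<open>Transposing values shows that all admissible values at one further position occur equally
  often.\<close>

lemma card_permutations_of_set_fixing:
  assumes "finite I" "finite A" "I \<subseteq> {..<card A}" "inj_on f I" "f ` I \<subseteq> A"
  shows "card {u \<in> permutations_of_set A. \<forall>i\<in>I. u ! i = f i} = fact (card A - card I)"
  using assms(1,3-5)
proof (induction I rule: finite_induct)
  case empty
  then show ?case by (simp add: assms(2))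
next
  case (insert k I)
  define X where "X a = {u \<in> permutations_of_set A. (\<forall>i\<in>I. u ! i = f i) \<and> u ! k = a}" for a
  have fin: "finite (X a)" for a by (simp add: X_def)
  have le: "card (X a) \<le> card (X b)" if "a \<in> A - f ` I" "b \<in> A - f ` I" for a b
  proof (rule card_inj_on_le[where f = "map (Transposition.transpose a b)"])
    show "inj_on (map (Transposition.transpose a b)) (X a)"
      using inj_on_subset[OF inj_mapI[OF inj_transpose] subset_UNIV] .
    show "map (Transposition.transpose a b) ` X a \<subseteq> X b"
    proof safe
      fix u assume u: "u \<in> X a"
      then have *: "set u = A" "distinct u" "\<forall>i\<in>I. u ! i = f i" "u ! k = a"
        by (auto simp: X_def permutations_of_set_def)
      then have len: "length u = card A" using distinct_card by force
      have "Transposition.transpose a b ` A = A"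
        using that by (intro transpose_image_eq) auto
      \<comment> \<open>Neither \<open>a\<close> nor \<open>b\<close> lies in the image of
        \<open>I\<close> under \<open>f\<close>, so the transposition moves no value that is already
        prescribed.\<close>
      moreover have "map (Transposition.transpose a b) u ! i = f i" if "i \<in> I" for i
      proof -
        have "f i \<noteq> a" "f i \<noteq> b"
          using that \<open>a \<in> A - f ` I\<close> \<open>b \<in> A - f ` I\<close> by blast+
        then show ?thesis using * len insert.prems that by (subst nth_map) auto
      qed
      moreover have "map (Transposition.transpose a b) u ! k = b"
        using * len insert.prems by (subst nth_map) auto
      ultimately show "map (Transposition.transpose a b) u \<in> X b"
        using * by (auto simp: X_def permutations_of_set_def distinct_map)
    qed
  qed (rule fin)
  have fk: "f k \<in> A - f ` I" using insert by auto
  have split: "{u \<in> permutations_of_set A. \<forall>i\<in>I. u ! i = f i} = (\<Union>a\<in>A - f ` I. X a)"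
  proof safe
    fix u assume u: "u \<in> permutations_of_set A" "\<forall>i\<in>I. u ! i = f i"
    then have *: "set u = A" "distinct u" by (auto simp: permutations_of_set_def)
    then have len: "length u = card A" using distinct_card by force
    have "u ! k \<in> A" using * len insert.prems by auto
    moreover have "u ! k \<noteq> f i" if "i \<in> I" for i
    proof -
      have "u ! k \<noteq> u ! i"
        using * len insert.prems insert.hyps that by (subst nth_eq_iff_index_eq) auto
      then show ?thesis using u that by simp
    qed
    ultimately show "u \<in> (\<Union>a\<in>A - f ` I. X a)" using u by (auto simp: X_def)
  qed (auto simp: X_def)
  have "fact (card A - card I) = card (\<Union>a\<in>A - f ` I. X a)"
    using insert split by simp
  also have "\<dots> = (\<Sum>a\<in>A - f ` I. card (X a))"
    using assms(2) fin by (intro card_UN_disjoint) (auto simp: X_def)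
  also have "\<dots> = (\<Sum>a\<in>A - f ` I. card (X (f k)))"
    using le fk by (intro sum.cong refl antisym) auto
  also have "\<dots> = (card A - card I) * card (X (f k))"
    using insert by (simp add: card_Diff_subset card_image)
  finally have eq: "fact (card A - card I) = (card A - card I) * card (X (f k))" .
  \<comment> \<open>Since \<open>k\<close> is a further position outside \<open>I\<close>, the
    factor \<open>card A - card I\<close> is positive and cancels against the leading factor of its
    factorial.\<close>
  have "card (insert k I) \<le> card {..<card A}"
    using insert.prems by (intro card_mono) auto
  then obtain m where m: "card A - card I = Suc m"
    using insert.hyps by (metis Suc_diff_Suc Suc_le_lessD card_insert_disjoint card_lessThan)
  then have "card (X (f k)) = fact m" using eq by (simp del: mult_Suc)
  moreover have "card A - card (insert k I) = m" using m insert.hyps by simp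
  moreover have "{u \<in> permutations_of_set A. \<forall>i\<in>insert k I. u ! i = f i} = X (f k)"
    by (auto simp: X_def)
  ultimately show ?case by simp
qed

section \<open>Sums over subsets of a finite family\<close>

text \<open>The parts \<open>T \<inter> R\<close> and \<open>T - R\<close> can be chosen
  independently.\<close>

lemma card_subsets_meeting:
  assumes "finite B" "R \<subseteq> B" "m \<le> k"
  shows "card {T. T \<subseteq> B \<and> card T = k \<and> card (T \<inter> R) = m} =
    (card R choose m) * (card (B - R) choose (k - m))"
proof -
  have fin: "finite R" "finite (B - R)" using assms finite_subset by auto
  have "bij_betw (\<lambda>T. (T \<inter> R, T - R)) {T. T \<subseteq> B \<and> card T = k \<and> card (T \<inter> R) = m}
     ({U. U \<subseteq> R \<and> card U = m} \<times> {V. V \<subseteq> B - R \<and> card V = k - m})"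
  proof (rule bij_betw_byWitness[where f' = "\<lambda>(U, V). U \<union> V"], goal_cases)
    \<comment> \<open>Cases 3 and 4 say that the map and its inverse land in the right sets.\<close>
    case 3
    show ?case
    proof safe
      fix T assume "T \<subseteq> B"
      with assms(1) have "finite T" by (rule finite_subset[rotated])
      then show "card (T - R) = card T - card (T \<inter> R)" by (simp add: card_Diff_subset_Int)
    qed auto
  next
    case 4
    show ?case
    proof safe
      fix U V assume UV: "U \<subseteq> R" "V \<subseteq> B - R" "card V = k - card U" "m = card U"
      have "finite U" "finite V" using UV fin finite_subset by metis+
      moreover have "U \<inter> V = {}" using UV by auto
      ultimately show "card (U \<union> V) = k" using UV assms(3) by (simp add: card_Un_disjoint)
      have "(U \<union> V) \<inter> R = U" using UV by auto
      then show "card ((U \<union> V) \<inter> R) = card U" by simp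
    qed (use assms in auto)
  qed auto
  then show ?thesis
    using fin by (simp add: bij_betw_same_card card_cartesian_product n_subsets)
qed

text \<open>Group by \<open>m = card (T \<inter> R)\<close>. Letting \<open>m\<close> run up to
  \<open>k\<close> is harmless for small \<open>R\<close> or \<open>B - R\<close>, because binomial
  coefficients vanish out of range.\<close>

lemma sum_subsets_meeting:
  fixes h :: "nat \<Rightarrow> real"
  assumes "finite B" "R \<subseteq> B"
  shows "(\<Sum>T | T \<subseteq> B \<and> card T = k. h (card (T \<inter> R))) =
    (\<Sum>m\<le>k. real (card R choose m) * real (card (B - R) choose (k - m)) * h m)"
proof -
  let ?S = "{T. T \<subseteq> B \<and> card T = k}"
  have fin: "finite ?S" using assms by simp
  have "card (T \<inter> R) \<le> k" if "T \<in> ?S" for T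
  proof -
    have "finite T" using that assms finite_subset by auto
    then show ?thesis using that card_mono[of T "T \<inter> R"] by auto
  qed
  then have "(\<Sum>T\<in>?S. h (card (T \<inter> R))) =
      (\<Sum>m\<le>k. \<Sum>T | T \<in> ?S \<and> card (T \<inter> R) = m. h (card (T \<inter> R)))"
    using fin by (intro sum.group[symmetric]) auto
  also have "\<dots> = (\<Sum>m\<le>k. real (card {T. T \<subseteq> B \<and> card T = k \<and> card (T \<inter> R) = m}) * h m)"
    by (intro sum.cong) (auto simp: conj_assoc)
  finally show ?thesis using assms by (simp add: card_subsets_meeting)
qed

text \<open>By disjointness, \<open>S\<close> splits uniquely into its one member in
  \<open>\<A>\<close> and its part in \<open>\<B>\<close>.\<close>

lemma sum_one_and_subset:
  fixes g :: "'a set \<Rightarrow> real"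
  assumes "\<A> \<inter> \<B> = {}"
  shows "(\<Sum>S | S \<subseteq> \<A> \<union> \<B> \<and> card (S \<inter> \<A>) = 1 \<and> card (S \<inter> \<B>) = k. g S) =
    (\<Sum>H\<in>\<A>. \<Sum>T | T \<subseteq> \<B> \<and> card T = k. g (insert H T))"
proof -
  have meet: "insert H T \<inter> \<A> = {H}" "insert H T \<inter> \<B> = T" if "H \<in> \<A>" "T \<subseteq> \<B>" for H T
    using that assms by auto
  have "(\<Sum>S | S \<subseteq> \<A> \<union> \<B> \<and> card (S \<inter> \<A>) = 1 \<and> card (S \<inter> \<B>) = k. g S) =
    (\<Sum>(H, T)\<in>\<A> \<times> {T. T \<subseteq> \<B> \<and> card T = k}. g (insert H T))"
  proof (rule sum.reindex_bij_witness[where j = "\<lambda>S. (the_elem (S \<inter> \<A>), S \<inter> \<B>)"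
        and i = "\<lambda>(H, T). insert H T"], goal_cases)
    case (1 S)
    then obtain H where H: "S \<inter> \<A> = {H}" by (auto simp: card_1_singleton_iff)
    have "insert H (S \<inter> \<B>) = (S \<inter> \<A>) \<union> (S \<inter> \<B>)" using H by simp
    also have "\<dots> = S" using 1 by auto
    finally show ?case using H by simp
  next
    case (2 S)
    then obtain H where "S \<inter> \<A> = {H}" by (auto simp: card_1_singleton_iff)
    then show ?case using 2 by auto
  next
    \<comment> \<open>The deleted rules could rewrite intersections with \<open>insert H T\<close>
      before \<open>meet\<close> applies.\<close>
    case (3 HT)
    then show ?case
      using assms by (auto simp: meet simp del: Int_insert_left_if0 Int_insert_left_if1)
  next
    case (4 HT)
    then show ?case
      using assms by (auto simp: meet simp del: Int_insert_left_if0 Int_insert_left_if1)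
  next
    case (5 S)
    then obtain H where H: "S \<inter> \<A> = {H}" by (auto simp: card_1_singleton_iff)
    have "insert H (S \<inter> \<B>) = (S \<inter> \<A>) \<union> (S \<inter> \<B>)" using H by simp
    also have "\<dots> = S" using 5 by auto
    finally show ?case using H by simp
  qed
  then show ?thesis by (simp add: sum.cartesian_product)
qed

section \<open>Families of subnetworks with two fixed positions\<close>

text \<open>Positions count from 0. Keeping them as parameters lets one argument serve all three
  forms, in either order of their positions.\<close>

definition subnet_at :: "nat \<Rightarrow> nat \<Rightarrow> nat \<Rightarrow> nat \<Rightarrow> nat \<Rightarrow> nat list set" where
  "subnet_at n i j a b = {u \<in> permutations_of_set {1..n}. u ! i = a \<and> u ! j = b}"

definition subnets_at :: "nat \<Rightarrow> nat \<Rightarrow> nat \<Rightarrow> nat list set set" where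
  "subnets_at n i j = (\<lambda>(a, b). subnet_at n i j a b) ` (SIGMA a:{1..n}. {1..n} - {a})"

lemma finite_subnet_at [simp]: "finite (subnet_at n i j a b)"
  by (simp add: subnet_at_def)

lemma finite_subnets_at [simp]: "finite (subnets_at n i j)"
  by (simp add: subnets_at_def)

lemma in_subnets_at_iff:
  "H \<in> subnets_at n i j \<longleftrightarrow>
    (\<exists>a b. H = subnet_at n i j a b \<and> a \<in> {1..n} \<and> b \<in> {1..n} \<and> a \<noteq> b)"
  by (auto simp: subnets_at_def image_iff Bex_def)

lemma card_subnet_at:
  assumes "i < n" "j < n" "i \<noteq> j" "a \<in> {1..n}" "b \<in> {1..n}" "a \<noteq> b"
  shows "card (subnet_at n i j a b) = fact (n - 2)"
proof -
  have "subnet_at n i j a b =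
      {u \<in> permutations_of_set {1..n}. \<forall>x\<in>{i, j}. u ! x = (if x = i then a else b)}"
    using assms by (auto simp: subnet_at_def)
  also have "card \<dots> = fact (n - 2)"
    using assms by (subst card_permutations_of_set_fixing) (auto simp: eval_nat_numeral)
  finally show ?thesis .
qed

lemma card_subnet_at_Int:
  assumes "i < n" "j < n" "k < n" "distinct [i, j, k]"
    and "a \<in> {1..n}" "b \<in> {1..n}" "c \<in> {1..n}" "distinct [a, b, c]"
  shows "card (subnet_at n i j a b \<inter> {u. u ! k = c}) = fact (n - 3)"
proof -
  have "subnet_at n i j a b \<inter> {u. u ! k = c} =
      {u \<in> permutations_of_set {1..n}. \<forall>x\<in>{i, j, k}. u ! x = (if x = i then a else if x = j then b else c)}"
    using assms by (auto simp: subnet_at_def)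
  also have "card \<dots> = fact (n - 3)"
    using assms by (subst card_permutations_of_set_fixing) (auto simp: eval_nat_numeral)
  finally show ?thesis .
qed

lemma subnet_at_nonempty:
  assumes "i < n" "j < n" "i \<noteq> j" "a \<in> {1..n}" "b \<in> {1..n}" "a \<noteq> b"
  shows "subnet_at n i j a b \<noteq> {}"
  using card_subnet_at[OF assms] by (metis card.empty fact_nonzero)

text \<open>Any member \<open>u\<close> reveals both parameters as \<open>u ! i\<close> and
  \<open>u ! j\<close>, and nonemptiness supplies one.\<close>

lemma inj_on_subnet_at:
  assumes "i < n" "j < n" "i \<noteq> j"
  shows "inj_on (\<lambda>(a, b). subnet_at n i j a b) (SIGMA a:{1..n}. {1..n} - {a})"
proof (rule inj_onI)
  fix x y
  assume x: "x \<in> (SIGMA a:{1..n}. {1..n} - {a})"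
    and eq: "(case x of (a, b) \<Rightarrow> subnet_at n i j a b) = (case y of (a, b) \<Rightarrow> subnet_at n i j a b)"
  obtain a b where ab: "x = (a, b)" by (cases x)
  obtain c d where cd: "y = (c, d)" by (cases y)
  have "a \<in> {1..n}" "b \<in> {1..n}" "a \<noteq> b" using x ab by auto
  from subnet_at_nonempty[OF assms this] obtain u where u: "u \<in> subnet_at n i j a b" by blast
  moreover have "u \<in> subnet_at n i j c d" using u eq ab cd by simp
  ultimately show "x = y" by (simp add: subnet_at_def ab cd)
qed

lemma card_subnets_at:
  assumes "i < n" "j < n" "i \<noteq> j"
  shows "card (subnets_at n i j) = n * (n - 1)"
  unfolding subnets_at_def card_image[OF inj_on_subnet_at[OF assms]] by simp

lemma nth_permutation_neq:
  assumes "u \<in> permutations_of_set {1..n}" "i < n" "j < n" "i \<noteq> j"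
  shows "u ! i \<noteq> u ! j"
proof -
  have "distinct u" "length u = n"
    using assms distinct_card[of u] by (auto simp: permutations_of_set_def)
  then show ?thesis using assms by (simp add: nth_eq_iff_index_eq)
qed

text \<open>A set in both families would have a constant entry at \<open>j\<close>, a position
  outside \<open>{k, l}\<close>. Prescribing that entry cuts \<open>(n - 2)!\<close> elements down
  to \<open>(n - 3)!\<close>, a strict drop because \<open>n \<ge> 4\<close>. The position
  \<open>i\<close> may equal \<open>k\<close> or \<open>l\<close>, as happens for forms sharing a
  position.\<close>

lemma subnets_at_disjoint:
  assumes "n \<ge> 4" "i < n" "j < n" "k < n" "l < n" "i \<noteq> j" "distinct [j, k, l]"
  shows "subnets_at n i j \<inter> subnets_at n k l = {}"
proof (rule ccontr)
  assume "\<not> ?thesis"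
  then obtain a b c d where ab: "a \<in> {1..n}" "b \<in> {1..n}" "a \<noteq> b"
    and cd: "c \<in> {1..n}" "d \<in> {1..n}" "c \<noteq> d"
    and eq: "subnet_at n i j a b = subnet_at n k l c d"
    by (auto simp del: atLeastAtMost_iff simp: in_subnets_at_iff)
  obtain u where "u \<in> subnet_at n i j a b" "u \<in> subnet_at n k l c d"
    using subnet_at_nonempty[of i n j a b] ab assms eq by auto
  then have "distinct [c, d, b]"
    using nth_permutation_neq[of u n] assms by (auto simp: subnet_at_def)
  then have "card (subnet_at n k l c d \<inter> {u. u ! j = b}) = fact (n - 3)"
    using assms ab cd by (intro card_subnet_at_Int) auto
  moreover have "subnet_at n k l c d \<inter> {u. u ! j = b} = subnet_at n k l c d"
    using eq by (auto simp: subnet_at_def)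
  ultimately have "fact (n - 3) = (fact (n - 2) :: nat)"
    using card_subnet_at[of k n l c d] cd assms by simp
  moreover have "fact (n - 3) < (fact (n - 2) :: nat)"
    using assms(1) by (intro fact_less_mono_nat) auto
  ultimately show False by simp
qed

section \<open>Size of the union of the chosen subnetworks\<close>

text \<open>Overlaps occur only between the inserted set and members of \<open>T\<close>, so
  inclusion-exclusion needs a single correction. \<open>R\<close> collects the candidates that meet
  the inserted set.\<close>

lemma card_Union_insert_subnets_at:
  assumes n: "n \<ge> 4" and ijk: "i < n" "j < n" "k < n" "distinct [i, j, k]"
    and ab: "a \<in> {1..n}" "b \<in> {1..n}" "a \<noteq> b"
    and T: "T \<subseteq> subnets_at n i k"
  defines "R \<equiv> subnet_at n i k a ` ({1..n} - {a, b})"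
  shows "card (\<Union>(insert (subnet_at n i j a b) T)) =
    Suc (card T) * fact (n - 2) - card (T \<inter> R) * fact (n - 3)"
proof -
  let ?H = "subnet_at n i j a b"
  have finT: "finite T" using T finite_subset finite_subnets_at by blast
  have repr: "\<exists>c d. B = subnet_at n i k c d \<and> c \<in> {1..n} \<and> d \<in> {1..n} \<and> c \<noteq> d" if "B \<in> T" for B
    using T that subsetD[OF T that] unfolding in_subnets_at_iff by blast
  have fin: "finite B" if "B \<in> T" for B using repr[OF that] by auto
  \<comment> \<open>Distinct members prescribe different values at \<open>i\<close> or at
    \<open>k\<close>.\<close>
  have disj: "B \<inter> B' = {}" if "B \<in> T" "B' \<in> T" "B \<noteq> B'" for B B'
    using repr[OF that(1)] repr[OF that(2)] that(3) by (auto simp: subnet_at_def)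
  have cardT: "card (\<Union>T) = card T * fact (n - 2)"
  proof -
    have "card (\<Union>T) = (\<Sum>B\<in>T. card B)"
      using finT fin disj by (intro card_Union_disjoint) (auto simp: pairwise_def disjnt_def)
    also have "\<dots> = (\<Sum>B\<in>T. fact (n - 2))"
      using repr ijk by (intro sum.cong refl) (metis card_subnet_at distinct_length_2_or_more)
    finally show ?thesis by simp
  qed
  have meet: "card (?H \<inter> B) = (if B \<in> R then fact (n - 3) else 0)" if "B \<in> T" for B
  proof -
    from repr[OF that] obtain c d where B: "B = subnet_at n i k c d"
      and cd: "c \<in> {1..n}" "d \<in> {1..n}" "c \<noteq> d" by blast
    have R: "B \<in> R \<longleftrightarrow> c = a \<and> d \<noteq> b"
      using inj_onD[OF inj_on_subnet_at[of i n k], of "(c, d)" "(a, _)"] ijk cd ab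
      by (auto simp: R_def B)
    show ?thesis
    proof (cases "B \<in> R")
      case True
      then have "?H \<inter> B = ?H \<inter> {u. u ! k = d}"
        using R by (auto simp: B subnet_at_def)
      then show ?thesis
        using True R ijk ab cd card_subnet_at_Int[of i n j k a b d] by auto
    next
      case False
      \<comment> \<open>A common permutation would have two values at \<open>i\<close> if
        \<open>c \<noteq> a\<close>, and the same value at the different positions \<open>j\<close>
        and \<open>k\<close> if \<open>d = b\<close>.\<close>
      then have "c \<noteq> a \<or> d = b" using R by blast
      then have "?H \<inter> B = {}"
        using nth_permutation_neq[of _ n k j] ijk by (auto simp: B subnet_at_def)
      then show ?thesis using False by simp
    qed
  qed
  have cardHT: "card (?H \<inter> \<Union>T) = card (T \<inter> R) * fact (n - 3)"
  proof -
    have "card (\<Union>B\<in>T. ?H \<inter> B) = (\<Sum>B\<in>T. card (?H \<inter> B))"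
      using finT disj by (intro card_UN_disjoint) auto
    also have "\<dots> = (\<Sum>B\<in>T. if B \<in> R then fact (n - 3) else 0)"
      using meet by simp
    also have "\<dots> = card (T \<inter> R) * fact (n - 3)"
      using finT by (simp add: sum.inter_restrict[symmetric])
    finally show ?thesis by (simp add: Int_UN_distrib)
  qed
  have "card (?H \<union> \<Union>T) = card ?H + card (\<Union>T) - card (?H \<inter> \<Union>T)"
    using finT fin card_Un_Int[of ?H "\<Union>T"] by simp
  then show ?thesis
    using cardT cardHT card_subnet_at[of i n j a b] ijk ab by simp
qed

section \<open>Closed form of the sum\<close>

text \<open>This form and the next also hold where the coefficient vanishes, so
  \<open>n = 4\<close>, with \<open>n - 2 choose 3\<close> zero, needs no separate case.\<close>

lemma real_choose_2: "real (m choose 2) = real m * (real m - 1) / 2"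
  by (simp add: binomial_gbinomial gbinomial_prod_rev numeral_2_eq_2)

lemma real_choose_3: "real (m choose 3) = real m * (real m - 1) * (real m - 2) / 6"
  by (simp add: binomial_gbinomial gbinomial_prod_rev numeral_3_eq_3)

text \<open>Position \<open>i\<close> is the one shared by the two families. The value does not
  depend on the positions, which is why the three probabilities agree.\<close>

lemma sum_power_card_Union_subnets_at:
  fixes n :: nat and p :: real
  assumes n: "n \<ge> 4" and ijk: "i < n" "j < n" "k < n" "distinct [i, j, k]"
  shows "(\<Sum>S | S \<subseteq> subnets_at n i j \<union> subnets_at n i k \<and>
            card (S \<inter> subnets_at n i j) = 1 \<and> card (S \<inter> subnets_at n i k) = 3. p ^ card (\<Union>S)) =
      1 / 6 * (real n ^ 8 - 7 * real n ^ 7 + 21 * real n ^ 6 - 35 * real n ^ 5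
               + 34 * real n ^ 4 - 18 * real n ^ 3 + 4 * real n ^ 2)
        * p ^ (4 * fact (n - 2))
    + 1 / 2 * (real n ^ 7 - 7 * real n ^ 6 + 21 * real n ^ 5 - 35 * real n ^ 4
               + 34 * real n ^ 3 - 18 * real n ^ 2 + 4 * real n)
        * p ^ (4 * fact (n - 2) - fact (n - 3))
    + 1 / 2 * (real n ^ 6 - 8 * real n ^ 5 + 25 * real n ^ 4 - 40 * real n ^ 3
               + 34 * real n ^ 2 - 12 * real n)
        * p ^ (4 * fact (n - 2) - 2 * fact (n - 3))
    + 1 / 6 * (real n ^ 5 - 10 * real n ^ 4 + 35 * real n ^ 3 - 50 * real n ^ 2 + 24 * real n)
        * p ^ (4 * fact (n - 2) - 3 * fact (n - 3))"
    (is "_ = ?rhs")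
proof -
  \<comment> \<open>The weight of a choice in which \<open>m\<close> of the three subnetworks meet
    the single one.\<close>
  define h where "h m = p ^ (4 * fact (n - 2) - m * fact (n - 3))" for m
  \<comment> \<open>The number \<open>n (n - 1) - (n - 2)\<close> of candidates disjoint from the
    single subnetwork, as a polynomial.\<close>
  define c where "c = real n ^ 2 - 2 * real n + 2"
  have inner: "(\<Sum>T | T \<subseteq> subnets_at n i k \<and> card T = 3. p ^ card (\<Union>(insert H T))) =
      (\<Sum>m\<le>3. real ((n - 2) choose m) * real ((n * (n - 1) - (n - 2)) choose (3 - m)) * h m)"
    if "H \<in> subnets_at n i j" for H
  proof -
    from that obtain a b where H: "H = subnet_at n i j a b"
      and ab: "a \<in> {1..n}" "b \<in> {1..n}" "a \<noteq> b" unfolding in_subnets_at_iff by blast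
    define R where "R = subnet_at n i k a ` ({1..n} - {a, b})"
    have R: "R \<subseteq> subnets_at n i k" using ab by (force simp: R_def subnets_at_def)
    \<comment> \<open>Different values at \<open>k\<close> give different sets, so \<open>R\<close>
      has one element for each value other than \<open>a\<close> and \<open>b\<close>.\<close>
    have "inj_on (subnet_at n i k a) ({1..n} - {a, b})"
      using inj_onD[OF inj_on_subnet_at[of i n k], of "(a, _)" "(a, _)"] ijk ab
      by (intro inj_onI) auto
    then have cardR: "card R = n - 2"
      using ab by (simp add: R_def card_image card_Diff_subset)
    then have cardR': "card (subnets_at n i k - R) = n * (n - 1) - (n - 2)"
      using R ijk finite_subset[OF R] by (simp add: card_Diff_subset card_subnets_at)
    have "(\<Sum>T | T \<subseteq> subnets_at n i k \<and> card T = 3. p ^ card (\<Union>(insert H T))) =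
        (\<Sum>T | T \<subseteq> subnets_at n i k \<and> card T = 3. h (card (T \<inter> R)))"
      using card_Union_insert_subnets_at[OF n ijk ab]
      by (intro sum.cong refl) (auto simp: H h_def R_def)
    also have "\<dots> = (\<Sum>m\<le>3. real (card R choose m) * real (card (subnets_at n i k - R) choose (3 - m)) * h m)"
      by (rule sum_subsets_meeting) (use R in auto)
    finally show ?thesis by (simp add: cardR cardR')
  qed
  have "subnets_at n i j \<inter> subnets_at n i k = {}"
    using n ijk by (intro subnets_at_disjoint) auto
  then have "(\<Sum>S | S \<subseteq> subnets_at n i j \<union> subnets_at n i k \<and>
            card (S \<inter> subnets_at n i j) = 1 \<and> card (S \<inter> subnets_at n i k) = 3. p ^ card (\<Union>S)) =
     (\<Sum>H\<in>subnets_at n i j. \<Sum>T | T \<subseteq> subnets_at n i k \<and> card T = 3. p ^ card (\<Union>(insert H T)))"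
    by (rule sum_one_and_subset)
  also have "\<dots> = real (n * (n - 1)) *
      (\<Sum>m\<le>3. real ((n - 2) choose m) * real ((n * (n - 1) - (n - 2)) choose (3 - m)) * h m)"
    using inner card_subnets_at[of i n j] ijk by (simp del: Union_insert)
  also have "\<dots> = real n * (real n - 1) *
      (c * (c - 1) * (c - 2) / 6 * h 0 + (real n - 2) * (c * (c - 1) / 2) * h 1
       + (real n - 2) * (real n - 3) / 2 * c * h 2
       + (real n - 2) * (real n - 3) * (real n - 4) / 6 * h 3)"
  proof -
    \<comment> \<open>Ensures that the natural-number difference is not truncated before passing to
      the reals.\<close>
    have "n - 2 \<le> n * (n - 1)" using n by (simp add: le_trans[of _ n])
    then have "real (n * (n - 1) - (n - 2)) = c"
      using n by (simp add: of_nat_diff c_def power2_eq_square algebra_simps)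
    moreover have "real (n - 2) = real n - 2" "real (n - 1) = real n - 1" using n by auto
    moreover have "{..3::nat} = {0, 1, 2, 3}" by auto
    ultimately show ?thesis by (simp add: real_choose_2 real_choose_3)
  qed
  also have "\<dots> = ?rhs"
    \<comment> \<open>Expanding \<open>c\<close> leaves a polynomial identity in
      \<open>real n\<close>, with the powers of \<open>p\<close> as atoms.\<close>
    unfolding h_def c_def by (simp, algebra)
  finally show ?thesis .
qed

section \<open>From the fault model to the combinatorial sum\<close>

lemma prob_all_fault_free:
  assumes "0 \<le> p" "p \<le> 1" and S: "\<Union>S \<subseteq> permutations_of_set {1..n}"
  shows "measure_pmf.prob (node_fault_model n p) {\<omega>. \<forall>H\<in>S. fault_free \<omega> H} = p ^ card (\<Union>S)"
proof -
  let ?V = "permutations_of_set {1..n}"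
  \<comment> \<open>The event is a product set: vertices in \<open>\<Union>S\<close> must be
    \<open>True\<close> and all others are free, so independence gives a product of
    probabilities.\<close>
  have "{\<omega>. \<forall>H\<in>S. fault_free \<omega> H} = Pi ?V (\<lambda>v. if v \<in> \<Union>S then {True} else UNIV)"
    using S by (fastforce simp: fault_free_def Pi_iff split: if_splits)
  then have "measure_pmf.prob (node_fault_model n p) {\<omega>. \<forall>H\<in>S. fault_free \<omega> H} =
      (\<Prod>v\<in>?V. measure_pmf.prob (bernoulli_pmf p) (if v \<in> \<Union>S then {True} else UNIV))"
    by (simp add: node_fault_model_def bubble_sort_network_def measure_Pi_pmf_Pi)
  \<comment> \<open>The bounds on \<open>p\<close> keep \<open>bernoulli_pmf\<close> from clamping
    its parameter.\<close>
  also have "\<dots> = (\<Prod>v\<in>?V. if v \<in> \<Union>S then p else 1)"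
    using assms(1,2) by (intro prod.cong) (auto simp: measure_pmf_single)
  also have "\<dots> = p ^ card (?V \<inter> \<Union>S)"
    by (subst prod.inter_restrict[symmetric]) simp_all
  finally show ?thesis using S by (simp add: inf_absorb2)
qed

text \<open>Exchanging the positions amounts to exchanging the values. This allows the shared
  position to be put first.\<close>

lemma subnets_at_commute: "subnets_at n i j = subnets_at n j i"
proof -
  have "subnets_at n i j \<subseteq> subnets_at n j i" for i j
  proof
    fix H assume "H \<in> subnets_at n i j"
    then obtain a b where "H = subnet_at n i j a b" "a \<in> {1..n}" "b \<in> {1..n}" "a \<noteq> b"
      unfolding in_subnets_at_iff by blast
    moreover have "subnet_at n i j a b = subnet_at n j i b a" by (auto simp: subnet_at_def)
    ultimately show "H \<in> subnets_at n j i" by (force simp: subnets_at_def)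
  qed
  then show ?thesis by blast
qed

text \<open>The suffix positions are reversed so that \<open>n - 1\<close>, which the middle form
  shares, comes first.\<close>

lemma subnets_eq_subnets_at:
  "prefix_subnets n = subnets_at n 0 1"
  "middle_subnets n = subnets_at n 0 (n - 1)"
  "suffix_subnets n = subnets_at n (n - 1) (n - 2)"
proof -
  show "prefix_subnets n = subnets_at n 0 1"
    unfolding prefix_subnets_def prefix_subnet_def subnets_at_def subnet_at_def
      bubble_sort_network_def by (auto simp: image_iff) blast+
  show "middle_subnets n = subnets_at n 0 (n - 1)"
    unfolding middle_subnets_def middle_subnet_def subnets_at_def subnet_at_def
      bubble_sort_network_def by (auto simp: image_iff) blast+
  show "suffix_subnets n = subnets_at n (n - 1) (n - 2)"
    unfolding subnets_at_commute[of n "n - 1"]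
    unfolding suffix_subnets_def suffix_subnet_def subnets_at_def subnet_at_def
      bubble_sort_network_def by (auto simp: image_iff) blast+
qed

lemma prob_fault_free_eq_sum:
  assumes "0 \<le> p" "p \<le> 1"
  shows "prob_fault_free n p i j k = (\<Sum>S\<in>subnet_choices n i j k. p ^ card (\<Union>S))"
  unfolding prob_fault_free_def
proof (intro sum.cong refl prob_all_fault_free assms)
  fix S assume "S \<in> subnet_choices n i j k"
  then show "\<Union>S \<subseteq> permutations_of_set {1..n}"
    unfolding subnet_choices_def subnets_eq_subnets_at subnets_at_def subnet_at_def by blast
qed

text \<open>Avoiding \<open>Z\<close> leaves \<open>S\<close> inside \<open>X \<union> Y\<close>,
  where disjointness makes the condition on \<open>card S\<close> automatic.\<close>

lemma subset_of_two_families: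
  assumes "finite X" "finite Y" "finite Z" "X \<inter> Y = {}" "X \<inter> Z = {}" "Y \<inter> Z = {}"
  shows "{S. S \<subseteq> X \<union> Y \<union> Z \<and> card S = x + y \<and> card (S \<inter> X) = x \<and> card (S \<inter> Y) = y \<and> card (S \<inter> Z) = 0}
    = {S. S \<subseteq> X \<union> Y \<and> card (S \<inter> X) = x \<and> card (S \<inter> Y) = y}"
proof -
  \<comment> \<open>Finiteness matters here, since \<open>card\<close> is 0 on infinite sets as
    well.\<close>
  have Z: "card (S \<inter> Z) = 0 \<longleftrightarrow> S \<inter> Z = {}" for S using assms(3) by simp
  have "card S = card (S \<inter> X) + card (S \<inter> Y)" if "S \<subseteq> X \<union> Y" for S
  proof -
    have "card (S \<inter> X \<union> S \<inter> Y) = card (S \<inter> X) + card (S \<inter> Y)"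
      using assms by (intro card_Un_disjoint) auto
    moreover have "S \<inter> X \<union> S \<inter> Y = S" using that by auto
    ultimately show ?thesis by simp
  qed
  then show ?thesis unfolding Z using assms by blast
qed

theorem theorem3:
  fixes n :: nat and p :: real
  assumes "n \<ge> 4" and "0 \<le> p" and "p \<le> 1"
  shows "prob_fault_free n p 1 3 0 = prob_fault_free n p 0 3 1 \<and>
    prob_fault_free n p 0 3 1 = prob_fault_free n p 0 1 3 \<and>
    prob_fault_free n p 0 1 3 =
      1 / 6 * (real n ^ 8 - 7 * real n ^ 7 + 21 * real n ^ 6 - 35 * real n ^ 5
               + 34 * real n ^ 4 - 18 * real n ^ 3 + 4 * real n ^ 2)
        * p ^ (4 * fact (n - 2))
    + 1 / 2 * (real n ^ 7 - 7 * real n ^ 6 + 21 * real n ^ 5 - 35 * real n ^ 4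
               + 34 * real n ^ 3 - 18 * real n ^ 2 + 4 * real n)
        * p ^ (4 * fact (n - 2) - fact (n - 3))
    + 1 / 2 * (real n ^ 6 - 8 * real n ^ 5 + 25 * real n ^ 4 - 40 * real n ^ 3
               + 34 * real n ^ 2 - 12 * real n)
        * p ^ (4 * fact (n - 2) - 2 * fact (n - 3))
    + 1 / 6 * (real n ^ 5 - 10 * real n ^ 4 + 35 * real n ^ 3 - 50 * real n ^ 2 + 24 * real n)
        * p ^ (4 * fact (n - 2) - 3 * fact (n - 3))"
proof -
  let ?P = "subnets_at n 0 1" and ?M = "subnets_at n 0 (n - 1)"
    and ?S = "subnets_at n (n - 1) (n - 2)"
  have PM: "?P \<inter> ?M = {}" using assms(1) by (intro subnets_at_disjoint) auto
  have PS: "?P \<inter> ?S = {}" using assms(1) by (intro subnets_at_disjoint) auto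
  \<comment> \<open>The middle positions are swapped so that the second one, 0, lies outside the
    suffix positions.\<close>
  have MS: "?M \<inter> ?S = {}"
    unfolding subnets_at_commute[of n 0] using assms(1) by (intro subnets_at_disjoint) auto
  \<comment> \<open>In each case the family contributing one member is listed first.\<close>
  have choices: "subnet_choices n 1 3 0 =
      {S. S \<subseteq> ?P \<union> ?M \<and> card (S \<inter> ?P) = 1 \<and> card (S \<inter> ?M) = 3}"
    "subnet_choices n 0 3 1 = {S. S \<subseteq> ?S \<union> ?M \<and> card (S \<inter> ?S) = 1 \<and> card (S \<inter> ?M) = 3}"
    "subnet_choices n 0 1 3 = {S. S \<subseteq> ?M \<union> ?S \<and> card (S \<inter> ?M) = 1 \<and> card (S \<inter> ?S) = 3}"
    using subset_of_two_families[of ?P ?M ?S 1 3] subset_of_two_families[of ?S ?M ?P 1 3]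
      subset_of_two_families[of ?M ?S ?P 1 3] PM PS MS
    by (simp_all add: subnet_choices_def subnets_eq_subnets_at Int_commute Un_ac conj_ac)
  show ?thesis
    unfolding prob_fault_free_eq_sum[OF assms(2,3)] choices
      subnets_at_commute[of n 0 "n - 1"]
    \<comment> \<open>The shared position is \<open>n - 1\<close> for middle and suffix forms and 0
      for prefix and middle forms. The instances treat, in order, a single suffix, middle and prefix
      subnetwork.\<close>
    using sum_power_card_Union_subnets_at[OF assms(1), of "n - 1" "n - 2" 0 p]
      sum_power_card_Union_subnets_at[OF assms(1), of "n - 1" 0 "n - 2" p]
      sum_power_card_Union_subnets_at[OF assms(1), of 0 1 "n - 1" p]
      assms(1) subnets_at_commute[of n 0 "n - 1"]
    by simp
qed

end
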